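(* Let $U_1,\dots,U_m\subset\mathbb{R}^n$ be nonempty closed convex sets with $U:=\bigcap_{i=1}^m U_i\neq\emptyset$, and let $(\varepsilon_k)_{k\ge1}\subset[0,1)$ satisfy $\sup_k\varepsilon_k<1$. Let $(x_k)_{k\ge1}$ be a sequence generated by A3PM with accuracies $(\varepsilon_k)$ for a starting point $x_1\in\mathbb{R}^n$, and let $\bar x\in U$ be its limit. Assume that the error bound condition holds for $\{U_i\}_{i=1}^m$ around $\bar x$, i.e. there exist $\omega\in(0,1)$ and a neighborhood $V$ of $\bar x$ such that $$\omega\,\operatorname{dist}(x,U)\le\max_{1\le i\le m}\operatorname{dist}(x,U_i)\quad\text{for all }x\in V.$$ Then $(x_k)$ converges linearly to $\bar x$.
   Context: $\mathbb{R}^n$ carries the Euclidean inner product and norm, and $\operatorname{dist}(x,C)=\inf_{y\in C}\|x-y\|$. Approximate projection: for a nonempty closed convex set $X\subset\mathbb{R}^n$, $\varepsilon\in[0,1)$ and $x\in\mathbb{R}^n$, an approximate projection $\widehat P_X(x,\varepsilon)$ of $x$ onto $X$ with accuracy $\varepsilon$ is any point $\widehat x\in\mathbb{R}^n$ such that (i) $\operatorname{dist}(\widehat x,X)\le\varepsilon\operatorname{dist}(x,X)$ and (ii) $X\subset\{z:\langle z-\widehat x,\,x-\widehat x\rangle\le0\}$. A sequence generated by A3PM (Approximate Parallel Polyhedral Projection Method) with accuracies $(\varepsilon_k)$ from $x_1$ is any sequence such that for every $k\ge1$ there are approximate projections $\widehat P_{U_i}(x_k,\varepsilon_k)$ of $x_k$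 onto $U_i$ ($i=1,\dots,m$) for which, with $$\widehat S_{ik}=\{z:\langle x_k-\widehat P_{U_i}(x_k,\varepsilon_k),\,z-\widehat P_{U_i}(x_k,\varepsilon_k)\rangle\le0\},\qquad \widehat\Omega_k=\bigcap_{i=1}^m\widehat S_{ik},$$ $x_{k+1}$ is an approximate projection of $x_k$ onto $\widehat\Omega_k$ with accuracy $\varepsilon_k$. Every such sequence converges to a point of $U$. Linear convergence of $(x_k)$ to $\bar x$ means: there is $r\in(0,1)$ such that $\|x_{k+1}-\bar x\|\le r\|x_k-\bar x\|$ for all sufficiently large $k$. *)

theory Defs
  imports "HOL-Analysis.Analysis"
begin

text \<open>
  The relation \<open>approx_proj X \<epsilon> x p\<close> is meant for nonempty closed convex \<open>X\<close> and \<open>0 \<le> \<epsilon> < 1\<close>;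
  \<^const>\<open>infdist\<close> is the usual distance only for nonempty sets (it is 0 for the empty set).
\<close>

definition approx_proj :: "'a::euclidean_space set \<Rightarrow> real \<Rightarrow> 'a \<Rightarrow> 'a \<Rightarrow> bool" where
  "approx_proj X \<epsilon> x p \<longleftrightarrow>
     infdist p X \<le> \<epsilon> * infdist x X \<and> X \<subseteq> {z. (z - p) \<bullet> (x - p) \<le> 0}"

text \<open>
  The set is the whole space if \<open>p = x\<close>.
\<close>

definition cut_halfspace :: "'a::euclidean_space \<Rightarrow> 'a \<Rightarrow> 'a set" where
  "cut_halfspace x p = {z. (x - p) \<bullet> (z - p) \<le> 0}"

text \<open>
  Sequences indexed by \<open>k \<ge> 1\<close> are functions on \<^typ>\<open>nat\<close> whose value at 0 is never
  constrained; likewise a family of sets is only used on the indices \<open>1, \<dots>, m\<close>.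
  In \<open>A3PM_sequence\<close> the starting point is \<open>x 1\<close>. If the sets \<open>U i\<close> have a common point, the
  intersection of the half-spaces contains it and so is nonempty, closed and convex.
\<close>

definition A3PM_sequence ::
  "nat \<Rightarrow> (nat \<Rightarrow> 'a::euclidean_space set) \<Rightarrow> (nat \<Rightarrow> real) \<Rightarrow> (nat \<Rightarrow> 'a) \<Rightarrow> bool" where
  "A3PM_sequence m U \<epsilon> x \<longleftrightarrow>
     (\<forall>k\<ge>1. \<exists>p. (\<forall>i\<in>{1..m}. approx_proj (U i) (\<epsilon> k) (x k) (p i)) \<and>
       approx_proj (\<Inter>i\<in>{1..m}. cut_halfspace (x k) (p i)) (\<epsilon> k) (x k) (x (Suc k)))"

definition error_bound_around ::
  "nat \<Rightarrow> (nat \<Rightarrow> 'a::euclidean_space set) \<Rightarrow> 'a \<Rightarrow> bool" where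
  "error_bound_around m U xbar \<longleftrightarrow>
     (\<exists>\<omega> V. 0 < \<omega> \<and> \<omega> < 1 \<and> xbar \<in> interior V \<and>
       (\<forall>x\<in>V. \<omega> * infdist x (\<Inter>i\<in>{1..m}. U i) \<le> Max ((\<lambda>i. infdist x (U i)) ` {1..m})))"

definition converges_linearly :: "(nat \<Rightarrow> 'a::euclidean_space) \<Rightarrow> 'a \<Rightarrow> bool" where
  "converges_linearly x xbar \<longleftrightarrow>
     (\<exists>r. 0 < r \<and> r < 1 \<and>
       (\<forall>\<^sub>F k in sequentially. norm (x (Suc k) - xbar) \<le> r * norm (x k - xbar)))"

end

theory Submission
  imports Defs
begin

text \<open>
  Each step moves at least \<open>(1 - \<epsilon> k)\<^sup>2 max\<^sub>i dist(x k, U i)\<close>, hence near \<open>xbar\<close> at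
  least a fixed multiple of \<open>dist(x k, U)\<close> by the error bound. The sequence is Fejer monotone with
  respect to \<open>U\<close>, and passing to the limit in Fejer monotonicity at a nearest point of \<open>U\<close>
  gives \<open>norm (x k - xbar) \<le> 2 dist(x k, U)\<close>. So the step length is at least a fixed multiple of
  \<open>norm (x k - xbar)\<close>, and by the obtuse angle condition its square is subtracted from
  \<open>(norm (x k - xbar))\<^sup>2\<close>.
\<close>

lemma approx_proj_step_ge:
  assumes "approx_proj X e x p"
  shows "(1 - e) * infdist x X \<le> dist x p"
proof -
  have "infdist x X \<le> infdist p X + dist x p"
    by (rule infdist_triangle)
  also have "infdist p X \<le> e * infdist x X"
    using assms by (simp add: approx_proj_def)
  finally show ?thesis
    by (simp add: algebra_simps)
qed

text \<open>Law of cosines for the triangle \<open>x\<close>, \<open>p\<close>, \<open>z\<close>: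
  the angle at \<open>p\<close> is not acute, so the cross term has the favourable sign.\<close>

lemma approx_proj_Fejer:
  assumes "approx_proj X e x p" "z \<in> X"
  shows "(dist p z)\<^sup>2 \<le> (dist x z)\<^sup>2 - (dist x p)\<^sup>2"
proof -
  have "(z - p) \<bullet> (x - p) \<le> 0"
    using assms by (auto simp: approx_proj_def)
  moreover have "(dist x z)\<^sup>2 = (dist x p)\<^sup>2 + (dist p z)\<^sup>2 - 2 * ((z - p) \<bullet> (x - p))"
    using dot_norm_neg[of "z - p" "x - p"] by (simp add: dist_norm norm_minus_commute)
  ultimately show ?thesis
    by linarith
qed

lemma approx_proj_subset_cut_halfspace:
  assumes "approx_proj X e x p"
  shows "X \<subseteq> cut_halfspace x p"
  using assms by (auto simp: approx_proj_def cut_halfspace_def inner_commute)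

text \<open>For \<open>x \<noteq> p\<close> the point \<open>p\<close> lies on the bounding
  hyperplane, whose normal is \<open>x - p\<close>, so it is the exact projection of
  \<open>x\<close> onto the half-space.\<close>

lemma dist_le_dist_cut_halfspace:
  assumes "z \<in> cut_halfspace x p"
  shows "dist x p \<le> dist x z"
proof (cases "x = p")
  case False
  have "norm (x - p) * norm (x - p) = (x - p) \<bullet> (x - p)"
    by (simp add: dot_square_norm power2_eq_square)
  also have "\<dots> \<le> (x - p) \<bullet> (x - z)"
    using assms by (simp add: cut_halfspace_def inner_diff_right)
  also have "\<dots> \<le> norm (x - p) * norm (x - z)"
    by (rule norm_cauchy_schwarz)
  finally show ?thesis
    using False by (simp add: dist_norm)
qed simp

text \<open>In the second claim one factor \<open>1 - \<epsilon> k\<close> is lost in the inexact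
  projection onto \<open>U i\<close>, the other in the inexact projection onto the intersection of
  the half-spaces.\<close>

lemma A3PM_step:
  assumes "A3PM_sequence m U \<epsilon> x" "k \<ge> 1"
    and z: "z \<in> (\<Inter>i\<in>{1..m}. U i)"
  shows A3PM_Fejer_decrease: "(dist (x (Suc k)) z)\<^sup>2 \<le> (dist (x k) z)\<^sup>2 - (dist (x k) (x (Suc k)))\<^sup>2"
    and A3PM_step_ge: "\<epsilon> k \<le> 1 \<Longrightarrow> i \<in> {1..m} \<Longrightarrow>
      (1 - \<epsilon> k)\<^sup>2 * infdist (x k) (U i) \<le> dist (x k) (x (Suc k))"
proof -
  obtain p where p: "\<forall>i\<in>{1..m}. approx_proj (U i) (\<epsilon> k) (x k) (p i)"
    and next_proj: "approx_proj (\<Inter>i\<in>{1..m}. cut_halfspace (x k) (p i)) (\<epsilon> k) (x k) (x (Suc k))"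
    using assms(1)[unfolded A3PM_sequence_def, rule_format, OF assms(2)] by (elim exE conjE)
  let ?\<Omega> = "\<Inter>i\<in>{1..m}. cut_halfspace (x k) (p i)"
  have z\<Omega>: "z \<in> ?\<Omega>"
  proof
    fix i assume "i \<in> {1..m}"
    then show "z \<in> cut_halfspace (x k) (p i)"
      using approx_proj_subset_cut_halfspace[OF p[rule_format]] z by blast
  qed
  show "(dist (x (Suc k)) z)\<^sup>2 \<le> (dist (x k) z)\<^sup>2 - (dist (x k) (x (Suc k)))\<^sup>2"
    by (rule approx_proj_Fejer[OF next_proj z\<Omega>])
  assume \<epsilon>: "\<epsilon> k \<le> 1" and i: "i \<in> {1..m}"
  have "(1 - \<epsilon> k) * infdist (x k) (U i) \<le> dist (x k) (p i)"
    by (rule approx_proj_step_ge[OF p[rule_format, OF i]])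
  \<comment> \<open>The polyhedron lies in the \<open>i\<close>-th half-space. The point
    \<open>z\<close> shows it to be nonempty, which excludes the default value 0 of
    \<open>infdist\<close>.\<close>
  also have "\<dots> \<le> infdist (x k) ?\<Omega>"
  proof -
    have "dist (x k) (p i) \<le> dist (x k) w" if "w \<in> ?\<Omega>" for w
      using that i by (intro dist_le_dist_cut_halfspace) auto
    with z\<Omega> show ?thesis
      by (subst infdist_notempty) (auto simp del: INT_iff intro!: cINF_greatest)
  qed
  finally have "(1 - \<epsilon> k) * ((1 - \<epsilon> k) * infdist (x k) (U i)) \<le> (1 - \<epsilon> k) * infdist (x k) ?\<Omega>"
    using \<epsilon> by (intro mult_left_mono) auto
  also have "\<dots> \<le> dist (x k) (x (Suc k))"
    by (rule approx_proj_step_ge[OF next_proj])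
  finally show "(1 - \<epsilon> k)\<^sup>2 * infdist (x k) (U i) \<le> dist (x k) (x (Suc k))"
    by (simp add: power2_eq_square mult.assoc)
qed

text \<open>From index \<open>k\<close> on the sequence stays in the closed ball around a nearest
  point \<open>y\<close> of \<open>S\<close> with radius \<open>infdist (x k) S\<close>. The limit
  lies in this ball too, and the bound is its diameter.\<close>

lemma Fejer_limit_dist_le:
  fixes x :: "nat \<Rightarrow> 'a::heine_borel"
  assumes "closed S" "S \<noteq> {}"
    and Fejer: "\<And>j z. j \<ge> k \<Longrightarrow> z \<in> S \<Longrightarrow> dist (x (Suc j)) z \<le> dist (x j) z"
    and "x \<longlonglongrightarrow> l"
  shows "dist (x k) l \<le> 2 * infdist (x k) S"
proof -
  obtain y where y: "y \<in> S" "infdist (x k) S = dist (x k) y"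
    using infdist_attains_inf[OF assms(1,2)] by blast
  have "dist (x j) y \<le> dist (x k) y" if "j \<ge> k" for j
    using that
  proof (induction j rule: dec_induct)
    case (step j)
    have "dist (x (Suc j)) y \<le> dist (x j) y"
      using step y(1) by (intro Fejer) auto
    with step show ?case by linarith
  qed simp
  then have "dist l y \<le> dist (x k) y"
    using \<open>x \<longlonglongrightarrow> l\<close>
    by (intro LIMSEQ_le_const2[OF tendsto_dist[OF _ tendsto_const]]) auto
  then show ?thesis
    using dist_triangle2[of "x k" l y] y(2) by linarith
qed

theorem theorem3p5:
  fixes U :: "nat \<Rightarrow> (real ^ 'n) set" and m :: nat
    and \<epsilon> :: "nat \<Rightarrow> real"
    and x :: "nat \<Rightarrow> real ^ 'n" and xbar :: "real ^ 'n"
  assumes "m \<ge> 1"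
    and "\<And>i. i \<in> {1..m} \<Longrightarrow> U i \<noteq> {} \<and> closed (U i) \<and> convex (U i)"
    and "(\<Inter>i\<in>{1..m}. U i) \<noteq> {}"
    and "\<And>k. k \<ge> 1 \<Longrightarrow> \<epsilon> k \<in> {0..<1}"
    and "(SUP k\<in>{1..}. \<epsilon> k) < 1"
    and "A3PM_sequence m U \<epsilon> x"
    and "x \<longlonglongrightarrow> xbar"
    and "xbar \<in> (\<Inter>i\<in>{1..m}. U i)"
    and "error_bound_around m U xbar"
  shows "converges_linearly x xbar"
proof -
  let ?U = "\<Inter>i\<in>{1..m}. U i"
  define e where "e = (SUP k\<in>{1..}. \<epsilon> k)"
  \<comment> \<open>The real supremum is an upper bound only of a set bounded above; here 1 is a
    bound.\<close>
  have e: "\<epsilon> k \<le> e" if "k \<ge> 1" for k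
    unfolding e_def using that assms(4)
    by (intro cSUP_upper bdd_aboveI2[where M = 1]) (auto simp: less_imp_le)
  have e01: "0 \<le> e" "e < 1"
    using e[of 1] assms(4)[of 1] assms(5) by (auto simp: e_def)
  obtain \<omega> V where \<omega>: "0 < \<omega>" "\<omega> < 1" and V: "xbar \<in> interior V"
    and bound: "\<And>y. y \<in> V \<Longrightarrow> \<omega> * infdist y ?U \<le> Max ((\<lambda>i. infdist y (U i)) ` {1..m})"
    using assms(9) unfolding error_bound_around_def by blast
  \<comment> \<open>The three factors come from the two inexact projections, the error bound, and
    the 2 in \<open>Fejer_limit_dist_le\<close>. The aim is a step length of at least
    \<open>c * dist (x k) xbar\<close>.\<close>
  define c where "c = (1 - e)\<^sup>2 * \<omega> / 2"
  have "(1 - e)\<^sup>2 * \<omega> < 1"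
  proof -
    have "(1 - e)\<^sup>2 * \<omega> \<le> 1 * \<omega>"
      using e01 \<omega> by (intro mult_right_mono power_le_one) auto
    with \<omega> show ?thesis by linarith
  qed
  then have c: "0 < c" "c < 1"
    using e01 \<omega> by (auto simp: c_def)
  \<comment> \<open>Both bounds matter: they put the rate \<open>sqrt (1 - c\<^sup>2)\<close>
    strictly between 0 and 1.\<close>
  have c2: "0 < c\<^sup>2" "c\<^sup>2 < 1"
    using c by (auto simp: power_less_one_iff)
  have decrease: "dist (x (Suc k)) z \<le> dist (x k) z" if "k \<ge> 1" "z \<in> ?U" for k z
  proof (rule power2_le_imp_le)
    show "(dist (x (Suc k)) z)\<^sup>2 \<le> (dist (x k) z)\<^sup>2"
      using A3PM_Fejer_decrease[OF assms(6) that] zero_le_power2[of "dist (x k) (x (Suc k))"]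
      by linarith
  qed simp
  have contraction: "norm (x (Suc k) - xbar) \<le> sqrt (1 - c\<^sup>2) * norm (x k - xbar)"
    if k: "k \<ge> 1" and xk: "x k \<in> V" for k
  proof -
    \<comment> \<open>As \<open>m \<ge> 1\<close>, the maximum is attained; the step estimate is
      then used for a set \<open>U i\<close> farthest from \<open>x k\<close>.\<close>
    have "Max ((\<lambda>i. infdist (x k) (U i)) ` {1..m}) \<in> (\<lambda>i. infdist (x k) (U i)) ` {1..m}"
      using assms(1) by (intro Max_in) auto
    then obtain i where i: "i \<in> {1..m}" "\<omega> * infdist (x k) ?U \<le> infdist (x k) (U i)"
      using bound[OF xk] by auto
    have "dist (x k) xbar \<le> 2 * infdist (x k) ?U"
    proof (rule Fejer_limit_dist_le)
      show "closed ?U"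
        using assms(2) by (intro closed_INT) simp
      show "dist (x (Suc j)) z \<le> dist (x j) z" if "j \<ge> k" "z \<in> ?U" for j z
        using decrease[of j z] that k by linarith
    qed (use assms(3,7) in simp_all)
    then have "c * dist (x k) xbar \<le> c * (2 * infdist (x k) ?U)"
      using c by (intro mult_left_mono) auto
    also have "\<dots> = (1 - e)\<^sup>2 * (\<omega> * infdist (x k) ?U)"
      by (simp add: c_def)
    also have "\<dots> \<le> (1 - \<epsilon> k)\<^sup>2 * infdist (x k) (U i)"
      using e[OF k] e01 \<omega> i(2) by (intro mult_mono power_mono) (auto simp: infdist_nonneg)
    also have "\<dots> \<le> dist (x k) (x (Suc k))"
      using A3PM_step_ge[OF assms(6) k assms(8) _ i(1)] assms(4)[OF k] by simp
    finally have "(c * dist (x k) xbar)\<^sup>2 \<le> (dist (x k) (x (Suc k)))\<^sup>2"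
      using c by (intro power_mono) auto
    \<comment> \<open>The limit \<open>xbar\<close> itself belongs to the intersection, so it may
      serve as the reference point of the Fejer decrease.\<close>
    then have "(dist (x (Suc k)) xbar)\<^sup>2 \<le> (1 - c\<^sup>2) * (dist (x k) xbar)\<^sup>2"
      using A3PM_Fejer_decrease[OF assms(6) k assms(8)]
      by (simp add: left_diff_distrib power_mult_distrib)
    also have "\<dots> = (sqrt (1 - c\<^sup>2) * dist (x k) xbar)\<^sup>2"
      using c2 by (simp add: power_mult_distrib)
    finally show ?thesis
      unfolding dist_norm using c2 by (elim power2_le_imp_le) auto
  qed
  have "\<forall>\<^sub>F k in sequentially. x k \<in> V"
    using topological_tendstoD[OF assms(7) open_interior V]
    by (rule eventually_mono) (use interior_subset in blast)
  then have "\<forall>\<^sub>F k in sequentially. norm (x (Suc k) - xbar) \<le> sqrt (1 - c\<^sup>2) * norm (x k - xbar)"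
    using eventually_ge_at_top[of 1] by eventually_elim (rule contraction)
  then show ?thesis
    unfolding converges_linearly_def using c2 by (intro exI[of _ "sqrt (1 - c\<^sup>2)"]) auto
qed

end
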